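(* Let $b\ge2$, $m\ge1$ and $n\ge0$ be integers, and let $N$ be the number of base-$b$ digits of $n$. For integers $0\le k_1,\dots,k_m\le n$ define $$\binom{n}{k_1,\dots,k_m}_b=\prod_{l=0}^{N-1}\binom{n_l}{(k_1)_l,\dots,(k_m)_l},$$ where $n_l$ and $(k_i)_l$ denote the rank-$l$ base-$b$ digits of $n$ and $k_i$, and for nonnegative integers $\binom{a}{c_1,\dots,c_m}=\frac{a!}{c_1!\cdots c_m!}$ if $c_1+\cdots+c_m=a$ and $0$ otherwise. Then for all $X_1,\dots,X_m\in\mathbb{C}$, $$(X_1+\cdots+X_m)^{S_b(n)}=\sum_{0\le k_1,\dots,k_m\le n}\binom{n}{k_1,\dots,k_m}_b X_1^{S_b(k_1)}\cdots X_m^{S_b(k_m)},$$ where $S_b(j)$ is the sum of the base-$b$ digits of $j$.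
   Context: Base-$b$ digits of $j\ge0$: the unique $j_l\in\{0,\dots,b-1\}$ with $j=\sum_l j_lb^l$. Convention $0^0=1$. *)

theory Defs
  imports Complex_Main "HOL-Library.FuncSet" "HOL-Library.Log_Nat"
begin

definition digit :: "nat \<Rightarrow> nat \<Rightarrow> nat \<Rightarrow> nat" where
  "digit b j l = j div b ^ l mod b"

text \<open>The lemmas \<open>digit_less\<close>, \<open>digit_expansion\<close> and \<open>digit_unique\<close> say that \<^term>\<open>digit b j\<close> is the unique base-\<open>b\<close> digit
  sequence of \<open>j\<close>. For \<open>b \<ge> 2\<close>, \<^term>\<open>floorlog b j\<close> is the number of base-\<open>b\<close> digits of
  \<open>j\<close> (rank of the leading nonzero digit plus one), with \<^prop>\<open>floorlog b 0 = 0\<close>. Counting one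
  digit for \<open>j = 0\<close> would change nothing: this only adds a term 0 to the digit sum and a factor
  \<open>0! / (0! \<cdots> 0!) = 1\<close> to the coefficient.\<close>

lemma digit_less: "b \<ge> 2 \<Longrightarrow> digit b j l < b"
  by (simp add: digit_def)

lemma digit_expansion:
  assumes "b \<ge> 2"
  shows "j = (\<Sum>l<floorlog b j. digit b j l * b ^ l)"
proof -
  have "j mod b ^ N = (\<Sum>l<N. digit b j l * b ^ l)" for N
  proof (induction N)
    case (Suc N)
    have "j mod b ^ Suc N = j mod (b ^ N * b)" by (simp add: mult.commute)
    also have "\<dots> = b ^ N * (j div b ^ N mod b) + j mod b ^ N" by (rule mod_mult2_eq)
    finally show ?case using Suc by (simp add: digit_def mult.commute)
  qed simp
  moreover have "j < b ^ floorlog b j"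
    using assms by (intro floorlog_leD) auto
  ultimately show ?thesis by (metis mod_less)
qed

lemma digit_unique:
  assumes "b \<ge> 2" "\<And>l. l < N \<Longrightarrow> d l < b" "j = (\<Sum>l<N. d l * b ^ l)" "l < N"
  shows "digit b j l = d l"
  using assms(2-)
proof (induction N arbitrary: d j l)
  case (Suc N)
  let ?r = "\<Sum>l<N. d (Suc l) * b ^ l"
  have j: "j = d 0 + b * ?r"
    by (simp add: Suc.prems(2) sum.lessThan_Suc_shift sum_distrib_left mult.left_commute
        del: sum.lessThan_Suc)
  have d0: "d 0 < b" using Suc.prems(1) by simp
  show ?case
  proof (cases l)
    case 0
    then show ?thesis using j d0 by (simp add: digit_def)
  next
    case (Suc l')
    have "digit b j l = digit b ?r l'"
      using j d0 by (simp add: digit_def Suc div_mult2_eq)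
    also have "\<dots> = d (Suc l')"
      using Suc Suc.prems by (intro Suc.IH) auto
    finally show ?thesis using Suc by simp
  qed
qed simp

definition digit_sum :: "nat \<Rightarrow> nat \<Rightarrow> nat" where
  "digit_sum b j = (\<Sum>l<floorlog b j. digit b j l)"

definition multinomial :: "nat \<Rightarrow> nat \<Rightarrow> (nat \<Rightarrow> nat) \<Rightarrow> 'a :: field_char_0" where
  "multinomial m a c =
     (if (\<Sum>i=1..m. c i) = a then fact a / (\<Prod>i=1..m. fact (c i)) else 0)"

definition base_multinomial :: "nat \<Rightarrow> nat \<Rightarrow> nat \<Rightarrow> (nat \<Rightarrow> nat) \<Rightarrow> 'a :: field_char_0" where
  "base_multinomial b m n k =
     (\<Prod>l<floorlog b n. multinomial m (digit b n l) (\<lambda>i. digit b (k i) l))"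

end

theory Submission
  imports Defs
begin

text \<open>For every digit rank the classical multinomial theorem expands a power of the sum of the
  \<open>X i\<close> with exponent \<open>digit b n l\<close>. Multiplying these expansions over all ranks below \<open>N\<close> and
  distributing gives a sum over matrices of digits, whose rows are exactly the digit sequences of
  arbitrary \<open>k i < b ^ N\<close>. Such a \<open>k\<close> contributes only if \<open>digit b (k i) l \<le> digit b n l\<close>
  everywhere, which forces \<open>k i \<le> n\<close>.\<close>

text \<open>Dividing by \<open>fact a\<close> turns the binomial theorem into a plain convolution,
  which makes induction on \<open>I\<close> easy. The exponent box \<open>{..<b}\<close> does not
  depend on \<open>a\<close>, so the induction hypothesis applies to every \<open>a - y\<close> over
  the same index set.\<close>

lemma sum_pow_div_fact_eq:
  fixes X :: "'i \<Rightarrow> 'a :: field_char_0"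
  assumes "finite I" "a < b"
  shows "(\<Sum>i\<in>I. X i) ^ a / fact a =
    (\<Sum>c \<in> I \<rightarrow>\<^sub>E {..<b}. if (\<Sum>i\<in>I. c i) = a then \<Prod>i\<in>I. X i ^ c i / fact (c i) else 0)"
  using assms
proof (induction I arbitrary: a rule: finite_induct)
  case empty
  \<comment> \<open>Both sides are 1 for \<open>a = 0\<close>, by the convention for
    \<open>0 ^ 0\<close>, and 0 otherwise.\<close>
  then show ?case by (cases a) auto
next
  case (insert x I)
  let ?S = "\<Sum>i\<in>I. X i"
  let ?P = "\<lambda>c. \<Prod>i\<in>I. X i ^ c i / fact (c i)"
  let ?G = "I \<rightarrow>\<^sub>E {..<b}"
  have "(\<Sum>c \<in> insert x I \<rightarrow>\<^sub>E {..<b}. if (\<Sum>i\<in>insert x I. c i) = a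
           then \<Prod>i\<in>insert x I. X i ^ c i / fact (c i) else 0)
      = (\<Sum>(y, g) \<in> {..<b} \<times> ?G. if y + (\<Sum>i\<in>I. g i) = a then X x ^ y / fact y * ?P g else 0)"
    unfolding PiE_insert_eq
  proof (subst sum.reindex[OF inj_combinator[OF insert.hyps(2)]], intro sum.cong refl, safe)
    fix y and g :: "'i \<Rightarrow> nat"
    have "(\<Sum>i\<in>I. (g(x := y)) i) = (\<Sum>i\<in>I. g i)" "?P (g(x := y)) = ?P g"
      using insert.hyps by (auto intro!: sum.cong prod.cong)
    then show "((\<lambda>c. if (\<Sum>i\<in>insert x I. c i) = a
           then \<Prod>i\<in>insert x I. X i ^ c i / fact (c i) else 0) \<circ> (\<lambda>(y, g). g(x := y))) (y, g) =
        (if y + (\<Sum>i\<in>I. g i) = a then X x ^ y / fact y * ?P g else 0)"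
      unfolding o_def prod.case sum.insert[OF insert.hyps] prod.insert[OF insert.hyps] fun_upd_same
      by (simp only:)
  qed
  also have "\<dots> = (\<Sum>y<b. \<Sum>g\<in>?G. if y + (\<Sum>i\<in>I. g i) = a then X x ^ y / fact y * ?P g else 0)"
    by (simp add: sum.cartesian_product)
  \<comment> \<open>An exponent \<open>y > a\<close> can never satisfy the sum condition, and
    \<open>a < b\<close> keeps every \<open>y \<le> a\<close> inside the box.\<close>
  also have "\<dots> = (\<Sum>y\<le>a. \<Sum>g\<in>?G. if y + (\<Sum>i\<in>I. g i) = a then X x ^ y / fact y * ?P g else 0)"
    using insert.prems by (intro sum.mono_neutral_right ballI sum.neutral) auto
  also have "\<dots> = (\<Sum>y\<le>a. X x ^ y / fact y * (?S ^ (a - y) / fact (a - y)))"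
  proof (rule sum.cong[OF refl])
    fix y assume "y \<in> {..a}"
    \<comment> \<open>Since \<open>y \<le> a\<close>, the subtraction is not truncated and the
      condition for \<open>a - y\<close> is the one for \<open>a\<close> with \<open>y\<close>
      added.\<close>
    then have "?S ^ (a - y) / fact (a - y) = (\<Sum>g\<in>?G. if y + (\<Sum>i\<in>I. g i) = a then ?P g else 0)"
      using insert.prems by (subst insert.IH) (auto intro!: sum.cong)
    then show "(\<Sum>g\<in>?G. if y + (\<Sum>i\<in>I. g i) = a then X x ^ y / fact y * ?P g else 0) =
        X x ^ y / fact y * (?S ^ (a - y) / fact (a - y))"
      by (simp add: sum_distrib_left if_distrib[of "\<lambda>t. _ * t"] cong: if_cong)
  qed
  also have "\<dots> = (\<Sum>y\<le>a. of_nat (a choose y) * X x ^ y * ?S ^ (a - y)) / fact a"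
    unfolding sum_divide_distrib
    by (intro sum.cong refl) (simp add: binomial_fact field_simps)
  also have "\<dots> = (X x + ?S) ^ a / fact a"
    by (simp add: binomial_ring)
  finally show ?case using insert.hyps by simp
qed

text \<open>The bound \<open>b\<close> in place of \<open>a\<close> lets all digit ranks share one
  index set, that of the possible digits.\<close>

lemma multinomial_theorem:
  fixes X :: "nat \<Rightarrow> 'a :: field_char_0"
  assumes "a < b"
  shows "(\<Sum>i=1..m. X i) ^ a =
    (\<Sum>c \<in> {1..m} \<rightarrow>\<^sub>E {..<b}. multinomial m a c * (\<Prod>i=1..m. X i ^ c i))"
proof -
  have "(\<Sum>i=1..m. X i) ^ a = fact a * ((\<Sum>i=1..m. X i) ^ a / fact a)"
    by simp
  also have "\<dots> = (\<Sum>c \<in> {1..m} \<rightarrow>\<^sub>E {..<b}. multinomial m a c * (\<Prod>i=1..m. X i ^ c i))"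
    unfolding sum_pow_div_fact_eq[OF finite_atLeastAtMost assms] sum_distrib_left
    by (intro sum.cong) (auto simp: multinomial_def prod_dividef)
  finally show ?thesis .
qed

lemma digit_eq_0:
  assumes "b \<ge> 2" "floorlog b j \<le> l"
  shows "digit b j l = 0"
  using floorlog_leD[of b j l] assms by (simp add: digit_def)

text \<open>Padding with leading zeros gives all numbers below \<open>b ^ N\<close> the common
  length \<open>N\<close>.\<close>

lemma digit_expansion_lessThan:
  assumes "b \<ge> 2" "j < b ^ N"
  shows "(\<Sum>l<N. digit b j l * b ^ l) = j"
proof -
  have "floorlog b j \<le> N" using assms by (intro floorlog_leI) auto
  then have "(\<Sum>l<floorlog b j. digit b j l * b ^ l) = (\<Sum>l<N. digit b j l * b ^ l)"
    using assms(1) by (intro sum.mono_neutral_left) (auto simp: digit_eq_0)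
  then show ?thesis using digit_expansion[OF assms(1), of j] by simp
qed

lemma digit_sum_eq_lessThan:
  assumes "b \<ge> 2" "j < b ^ N"
  shows "digit_sum b j = (\<Sum>l<N. digit b j l)"
proof -
  have "floorlog b j \<le> N" using assms by (intro floorlog_leI) auto
  then show ?thesis
    unfolding digit_sum_def using assms(1)
    by (intro sum.mono_neutral_left) (auto simp: digit_eq_0)
qed

lemma sum_digits_less_power:
  fixes b :: nat
  assumes "\<And>l. l < N \<Longrightarrow> d l < b"
  shows "(\<Sum>l<N. d l * b ^ l) < b ^ N"
  using assms
proof (induction N)
  case (Suc N)
  have "(\<Sum>l<N. d l * b ^ l) < b ^ N" using Suc by simp
  \<comment> \<open>The spare \<open>b ^ N\<close> absorbs the lower ranks.\<close>
  moreover have "Suc (d N) * b ^ N \<le> b * b ^ N"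
    using Suc.prems[of N] by (intro mult_right_mono) auto
  ultimately show ?case by simp
qed simp

text \<open>For fixed \<open>i\<close>, the entries \<open>C l i\<close> are the digits of one
  number. Uniqueness of digits and the digit expansion make reading off and reassembling inverse to
  each other; the restricted lambdas keep both maps extensional.\<close>

lemma sum_digit_matrix_reindex:
  fixes F :: "(nat \<Rightarrow> 'i \<Rightarrow> nat) \<Rightarrow> 'a :: comm_monoid_add"
  assumes "b \<ge> 2"
  shows "(\<Sum>C \<in> {..<N} \<rightarrow>\<^sub>E (I \<rightarrow>\<^sub>E {..<b}). F C) =
    (\<Sum>k \<in> I \<rightarrow>\<^sub>E {..<b ^ N}. F (\<lambda>l\<in>{..<N}. \<lambda>i\<in>I. digit b (k i) l))"
proof (rule sum.reindex_bij_witness[of _ "\<lambda>k. \<lambda>l\<in>{..<N}. \<lambda>i\<in>I. digit b (k i) l"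
      "\<lambda>C. \<lambda>i\<in>I. \<Sum>l<N. C l i * b ^ l"])
  fix C assume C: "C \<in> {..<N} \<rightarrow>\<^sub>E (I \<rightarrow>\<^sub>E {..<b})"
  have less: "C l i < b" if "l < N" "i \<in> I" for l i
    using C that by (auto simp: PiE_iff)
  have dig: "digit b (\<Sum>l<N. C l i * b ^ l) l = C l i" if "l < N" "i \<in> I" for l i
    using digit_unique[OF assms, of N "\<lambda>l. C l i"] less that by blast
  show inv: "(\<lambda>l\<in>{..<N}. \<lambda>i\<in>I. digit b ((\<lambda>i\<in>I. \<Sum>l<N. C l i * b ^ l) i) l) = C"
  proof (rule PiE_ext[OF _ C])
    show "(\<lambda>l\<in>{..<N}. \<lambda>i\<in>I. digit b ((\<lambda>i\<in>I. \<Sum>l<N. C l i * b ^ l) i) l)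
        \<in> {..<N} \<rightarrow>\<^sub>E (I \<rightarrow>\<^sub>E {..<b})"
      using assms by (auto simp: digit_less)
  next
    fix l assume l: "l \<in> {..<N}"
    then have "C l \<in> I \<rightarrow>\<^sub>E {..<b}" using C by auto
    then show "(\<lambda>l\<in>{..<N}. \<lambda>i\<in>I. digit b ((\<lambda>i\<in>I. \<Sum>l<N. C l i * b ^ l) i) l) l = C l"
      using l by (auto simp: dig fun_eq_iff PiE_iff extensional_def)
  qed
  show "(\<lambda>i\<in>I. \<Sum>l<N. C l i * b ^ l) \<in> I \<rightarrow>\<^sub>E {..<b ^ N}"
    using less by (auto intro: sum_digits_less_power)
  show "F (\<lambda>l\<in>{..<N}. \<lambda>i\<in>I. digit b ((\<lambda>i\<in>I. \<Sum>l<N. C l i * b ^ l) i) l) = F C"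
    by (simp only: inv)
next
  fix k assume k: "k \<in> I \<rightarrow>\<^sub>E {..<b ^ N}"
  then show "(\<lambda>i\<in>I. \<Sum>l<N. (\<lambda>l\<in>{..<N}. \<lambda>i\<in>I. digit b (k i) l) l i * b ^ l) = k"
    using assms
    by (auto simp: fun_eq_iff PiE_iff extensional_def digit_expansion_lessThan)
  show "(\<lambda>l\<in>{..<N}. \<lambda>i\<in>I. digit b (k i) l) \<in> {..<N} \<rightarrow>\<^sub>E (I \<rightarrow>\<^sub>E {..<b})"
    using assms by (auto simp: digit_less)
qed

lemma multinomial_cong:
  "(\<And>i. i \<in> {1..m} \<Longrightarrow> c i = d i) \<Longrightarrow> multinomial m a c = multinomial m a d"
  by (simp add: multinomial_def)

text \<open>A nonzero product has no zero factor, so at each rank the digits of the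
  \<open>k i\<close> add up to that of \<open>n\<close>, hence none exceeds it. The bound on
  \<open>k i\<close> ensures that these ranks see all of its digits.\<close>

lemma base_multinomial_nonzero_imp_le:
  assumes "b \<ge> 2" "base_multinomial b m n k \<noteq> 0" "i \<in> {1..m}" "k i < b ^ floorlog b n"
  shows "k i \<le> n"
proof -
  have "digit b (k i) l \<le> digit b n l" if "l < floorlog b n" for l
  proof -
    have "multinomial m (digit b n l) (\<lambda>i. digit b (k i) l) \<noteq> (0 :: 'a)"
      using assms(2) that by (simp add: base_multinomial_def)
    then have "(\<Sum>i=1..m. digit b (k i) l) = digit b n l"
      by (auto simp: multinomial_def split: if_splits)
    then show ?thesis
      using member_le_sum[of i "{1..m}" "\<lambda>i. digit b (k i) l"] assms(3) by simp
  qed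
  then have "(\<Sum>l<floorlog b n. digit b (k i) l * b ^ l) \<le> (\<Sum>l<floorlog b n. digit b n l * b ^ l)"
    by (intro sum_mono mult_right_mono) auto
  then show ?thesis
    using digit_expansion_lessThan[OF assms(1,4)] digit_expansion[OF assms(1), of n] by simp
qed

theorem theorem4p2:
  fixes b m n :: nat and X :: "nat \<Rightarrow> complex"
  assumes "b \<ge> 2" and "m \<ge> 1"
  shows "(\<Sum>i=1..m. X i) ^ digit_sum b n =
    (\<Sum>k \<in> {1..m} \<rightarrow>\<^sub>E {0..n}.
       base_multinomial b m n k * (\<Prod>i=1..m. X i ^ digit_sum b (k i)))"
proof -
  define N where "N = floorlog b n"
  let ?I = "{1..m}"
  \<comment> \<open>This covers \<open>n = 0\<close> too: then \<open>N = 0\<close> and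
    \<open>b ^ N = 1\<close>.\<close>
  have n: "n < b ^ N"
    unfolding N_def using assms(1) by (intro floorlog_leD) auto
  have "(\<Sum>i=1..m. X i) ^ digit_sum b n = (\<Prod>l<N. (\<Sum>i=1..m. X i) ^ digit b n l)"
    by (simp add: digit_sum_def N_def power_sum)
  also have "\<dots> = (\<Prod>l<N. \<Sum>c \<in> ?I \<rightarrow>\<^sub>E {..<b}.
      multinomial m (digit b n l) c * (\<Prod>i=1..m. X i ^ c i))"
    by (intro prod.cong refl multinomial_theorem digit_less assms)
  also have "\<dots> = (\<Sum>C \<in> {..<N} \<rightarrow>\<^sub>E (?I \<rightarrow>\<^sub>E {..<b}). \<Prod>l<N.
      multinomial m (digit b n l) (C l) * (\<Prod>i=1..m. X i ^ C l i))"
    by (intro prod_sum_PiE) (auto intro: finite_PiE)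
  also have "\<dots> = (\<Sum>k \<in> ?I \<rightarrow>\<^sub>E {..<b ^ N}. \<Prod>l<N.
      multinomial m (digit b n l) (\<lambda>i. digit b (k i) l) * (\<Prod>i=1..m. X i ^ digit b (k i) l))"
    \<comment> \<open>The reindexed matrices are restricted functions;
      \<open>multinomial_cong\<close> drops the restriction, as only indices in
      \<open>{1..m}\<close> matter.\<close>
    unfolding sum_digit_matrix_reindex[OF assms(1)]
    by (intro sum.cong prod.cong arg_cong2[of _ _ _ _ "(*)"] multinomial_cong refl) auto
  also have "\<dots> = (\<Sum>k \<in> ?I \<rightarrow>\<^sub>E {..<b ^ N}.
      base_multinomial b m n k * (\<Prod>i=1..m. X i ^ digit_sum b (k i)))"
  proof (rule sum.cong[OF refl])
    fix k assume k: "k \<in> ?I \<rightarrow>\<^sub>E {..<b ^ N}"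
    \<comment> \<open>Swapping the products collects, for each \<open>i\<close>, the powers of
      \<open>X i\<close> over all ranks, whose exponents add up to the digit sum.\<close>
    have "(\<Prod>l<N. \<Prod>i=1..m. X i ^ digit b (k i) l) = (\<Prod>i=1..m. \<Prod>l<N. X i ^ digit b (k i) l)"
      by (rule prod.swap)
    also have "\<dots> = (\<Prod>i=1..m. X i ^ digit_sum b (k i))"
    proof (rule prod.cong[OF refl])
      fix i assume "i \<in> ?I"
      then have "k i < b ^ N" using k by auto
      then show "(\<Prod>l<N. X i ^ digit b (k i) l) = X i ^ digit_sum b (k i)"
        by (simp add: digit_sum_eq_lessThan[OF assms(1)] power_sum)
    qed
    finally show "(\<Prod>l<N. multinomial m (digit b n l) (\<lambda>i. digit b (k i) l) *
          (\<Prod>i=1..m. X i ^ digit b (k i) l)) =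
        base_multinomial b m n k * (\<Prod>i=1..m. X i ^ digit_sum b (k i))"
      by (simp add: prod.distrib base_multinomial_def N_def)
  qed
  also have "\<dots> = (\<Sum>k \<in> ?I \<rightarrow>\<^sub>E {0..n}.
      base_multinomial b m n k * (\<Prod>i=1..m. X i ^ digit_sum b (k i)))"
  proof (rule sum.mono_neutral_right)
    show "finite (?I \<rightarrow>\<^sub>E {..<b ^ N})" by (intro finite_PiE) auto
    show "?I \<rightarrow>\<^sub>E {0..n} \<subseteq> ?I \<rightarrow>\<^sub>E {..<b ^ N}"
      using n by (intro PiE_mono) auto
    show "\<forall>k \<in> (?I \<rightarrow>\<^sub>E {..<b ^ N}) - (?I \<rightarrow>\<^sub>E {0..n}).
        base_multinomial b m n k * (\<Prod>i=1..m. X i ^ digit_sum b (k i)) = 0"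
    proof (rule ballI, rule ccontr)
      fix k
      assume k: "k \<in> (?I \<rightarrow>\<^sub>E {..<b ^ N}) - (?I \<rightarrow>\<^sub>E {0..n})"
        and "base_multinomial b m n k * (\<Prod>i=1..m. X i ^ digit_sum b (k i)) \<noteq> 0"
      then have "base_multinomial b m n k \<noteq> (0 :: complex)" by auto
      moreover have "k i < b ^ floorlog b n" if "i \<in> ?I" for i
        using k that by (auto simp: N_def)
      ultimately have "k i \<le> n" if "i \<in> ?I" for i
        using base_multinomial_nonzero_imp_le[OF assms(1)] that by blast
      \<comment> \<open>Extensionality of \<open>k\<close> is inherited from the larger box, so the
        bounds alone place it in the smaller one.\<close>
      then show False using k by (auto simp: PiE_iff)
    qed
  qed
  finally show ?thesis .
qed

end
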